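(* For any digraph $D$ of order $n$ and any integer $k$ with $1\le k\le n-1$, $\overleftrightarrow{\chi}(F_k(D))\le \overleftrightarrow{\chi}(D)$.
   Context: A digraph $D$ has a finite vertex set $V(D)$ and a set $A(D)$ of arcs, which are ordered pairs of distinct vertices (both $(x,y)$ and $(y,x)$ may be arcs). For a digraph $D$ of order $n$ and $1 \le k \le n-1$, the $k$-token digraph $F_k(D)$ has as vertices all $k$-subsets of $V(D)$, and $(A,B)$ is an arc of $F_k(D)$ whenever $A\setminus B=\{a\}$, $B\setminus A=\{b\}$ and $(a,b)\in A(D)$. An acyclic $r$-partition of $D$ is a partition of $V(D)$ into $r$ sets each inducing an acyclic subdigraph (one with no oriented cycle, where oriented cycles of length $2$ count as cycles). The dichromatic number $\overleftrightarrow{\chi}(D)$ is the smallest $r$ such that $D$ has an acyclic $r$-partition. *)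

theory Defs
  imports
    "HOL-Library.Disjoint_Sets"
    "Graph_Theory.Pair_Digraph"
    "Graph_Theory.Digraph_Component"
begin

text \<open>
  A digraph (finite, arcs are ordered pairs of distinct vertices) is a
  \<^typ>\<open>'a pair_pre_digraph\<close> satisfying \<^const>\<open>pair_digraph\<close>.
\<close>

definition token_digraph :: "nat \<Rightarrow> 'a pair_pre_digraph \<Rightarrow> 'a set pair_pre_digraph" where
  "token_digraph k D =
    \<lparr> pverts = {A. A \<subseteq> pverts D \<and> card A = k},
      parcs = {(A, B). A \<subseteq> pverts D \<and> card A = k \<and> B \<subseteq> pverts D \<and> card B = k \<and>
        (\<exists>a b. A - B = {a} \<and> B - A = {b} \<and> (a, b) \<in> parcs D)} \<rparr>"

text \<open>
  \<^const>\<open>pre_digraph.cycle\<close> admits closed walks of every positive length without repeated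
  vertices; in a loopfree digraph these are the oriented cycles of length at least 2.
\<close>

definition acyclic_digraph :: "('a, 'b) pre_digraph \<Rightarrow> bool" where
  "acyclic_digraph G \<longleftrightarrow> \<not> (\<exists>p. pre_digraph.cycle G p)"

definition acyclic_partition :: "'a pair_pre_digraph \<Rightarrow> nat \<Rightarrow> 'a set set \<Rightarrow> bool" where
  "acyclic_partition D r P \<longleftrightarrow>
    partition_on (pverts D) P \<and> finite P \<and> card P = r \<and>
    (\<forall>S \<in> P. acyclic_digraph (with_proj D \<restriction> S))"

definition dichromatic_number :: "'a pair_pre_digraph \<Rightarrow> nat" where
  "dichromatic_number D = (LEAST r. \<exists>P. acyclic_partition D r P)"

lemma pair_digraph_token_digraph:
  assumes "pair_digraph D"
  shows "pair_digraph (token_digraph k D)"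
proof -
  let ?V = "{A. A \<subseteq> pverts D \<and> card A = k}"
  have "finite (pverts D)"
    using assms by (rule pair_fin_digraph.pair_finite_verts[OF pair_digraph.axioms(1)])
  then have fin: "finite ?V" by simp
  have V: "pverts (token_digraph k D) = ?V"
    by (simp add: token_digraph_def)
  have sub: "parcs (token_digraph k D) \<subseteq> ?V \<times> ?V"
    unfolding token_digraph_def by auto
  have loopfree: "fst e \<noteq> snd e" if "e \<in> parcs (token_digraph k D)" for e
  proof
    assume "fst e = snd e"
    with that obtain A where "(A, A) \<in> parcs (token_digraph k D)"
      by (cases e) simp
    then show False
      unfolding token_digraph_def by simp
  qed
  show ?thesis
  proof
    show "fst e \<in> pverts (token_digraph k D)" "snd e \<in> pverts (token_digraph k D)"
      if "e \<in> parcs (token_digraph k D)" for e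
      using subsetD[OF sub that] unfolding V mem_Times_iff by simp_all
    show "finite (pverts (token_digraph k D))"
      unfolding V by (rule fin)
    show "finite (parcs (token_digraph k D))"
      using sub finite_cartesian_product[OF fin fin] by (rule finite_subset)
    show "fst e \<noteq> snd e" if "e \<in> parcs (token_digraph k D)" for e
      using that by (rule loopfree)
  qed
qed

text \<open>The partition into singletons is acyclic, so the minimum is attained.\<close>

lemma ex_acyclic_partition_dichromatic_number:
  assumes "pair_digraph D"
  shows "\<exists>P. acyclic_partition D (dichromatic_number D) P"
proof -
  interpret pair_digraph D by fact
  let ?P = "(\<lambda>v. {v}) ` pverts D"
  have "acyclic_digraph (with_proj D \<restriction> {v})" for v
  proof -
    have "arcs (with_proj D \<restriction> {v}) = {}"
      using pair_no_loops by fastforce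
    then have "p = []" if "set p \<subseteq> arcs (with_proj D \<restriction> {v})" for p
      using that by (metis set_empty subset_empty)
    then show ?thesis
      unfolding acyclic_digraph_def pre_digraph.cycle_def pre_digraph.awalk_def by blast
  qed
  moreover have "partition_on (pverts D) ?P"
    by (auto intro!: partition_onI)
  ultimately have "acyclic_partition D (card ?P) ?P"
    using pair_finite_verts by (auto simp: acyclic_partition_def)
  then have "\<exists>P. acyclic_partition D (card ?P) P"
    by blast
  then show ?thesis
    unfolding dichromatic_number_def by (rule LeastI[where P = "\<lambda>r. \<exists>P. acyclic_partition D r P"])
qed

end

theory Submission
  imports Defs "HOL-Number_Theory.Cong"
begin

text \<open>
  Take an acyclic partition of \<open>D\<close> with the least number \<open>r\<close> of parts, number the parts
  \<open>0, \<dots>, r - 1\<close>, and colour a \<open>k\<close>-set \<open>A\<close> with the sum of the colours of its elements modulo \<open>r\<close>.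
  An arc of the token digraph moves a single token along an arc \<open>(a, b)\<close> of \<open>D\<close>, so it joins two
  sets of equal colour only if \<open>a\<close> and \<open>b\<close> have the same colour: a monochromatic move is a move
  inside one part.

  Such moves cannot form an oriented cycle. Each part is acyclic, so its vertices can be ranked by
  natural numbers in a way that every arc inside the part goes up. A monochromatic move then
  strictly increases the sum of the ranks of the tokens, even though the moves along a walk
  may take place in different parts.

  The whole argument is thus about colourings together with a rank that increases along
  monochromatic arcs; \<open>acyclic_partition_imp_ranked_coloring\<close> and
  \<open>ranked_coloring_imp_dichromatic_number_le\<close> translate between these and acyclic
  partitions, and \<open>ranked_coloring_token_digraph\<close> transfers a colouring to the token digraph.
\<close>

definition ranked_coloring :: "'a pair_pre_digraph \<Rightarrow> nat \<Rightarrow> ('a \<Rightarrow> nat) \<Rightarrow> ('a \<Rightarrow> nat) \<Rightarrow> bool" where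
  "ranked_coloring D r f h \<longleftrightarrow>
    f ` pverts D \<subseteq> {..<r} \<and> (\<forall>(a, b) \<in> parcs D. f a = f b \<longrightarrow> h a < h b)"

text \<open>
  A closed walk contains a cycle, so excluding oriented cycles amounts to excluding
  nonempty closed walks, which are the pairs \<open>(x, x)\<close> of the transitive closure.
\<close>

lemma acyclic_digraph_iff_acyclic_arcs_ends:
  assumes "wf_digraph G"
  shows "acyclic_digraph G \<longleftrightarrow> acyclic (arcs_ends G)"
proof -
  interpret wf_digraph G by fact
  have "(\<exists>p. cycle p) \<longleftrightarrow> (\<exists>p. closed_w p)"
    using closed_w_imp_cycle cycle_altdef by blast
  also have "\<dots> \<longleftrightarrow> (\<exists>u. (u, u) \<in> (arcs_ends G)\<^sup>+)"
    unfolding closed_w_def reachable1_awalk by auto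
  finally show ?thesis
    unfolding acyclic_digraph_def acyclic_def by blast
qed

lemma finite_acyclic_imp_rank:
  assumes "finite R" and "acyclic R"
  shows "\<exists>h :: 'a \<Rightarrow> nat. \<forall>(a, b) \<in> R. h a < h b"
proof (intro exI ballI, clarify)
  fix a b assume ab: "(a, b) \<in> R"
  (* The rank of b is the number of its proper predecessors. *)
  show "card {x. (x, a) \<in> R\<^sup>+} < card {x. (x, b) \<in> R\<^sup>+}"
  proof (rule psubset_card_mono)
    have "{x. (x, b) \<in> R\<^sup>+} \<subseteq> fst ` (R\<^sup>+)"
      by force
    then show "finite {x. (x, b) \<in> R\<^sup>+}"
      using assms(1) by (meson finite_imageI finite_subset finite_trancl)
    have "(a, a) \<notin> R\<^sup>+"
      using assms(2) by (simp add: acyclic_def)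
    then show "{x. (x, a) \<in> R\<^sup>+} \<subset> {x. (x, b) \<in> R\<^sup>+}"
      using ab by (auto intro: trancl_into_trancl)
  qed
qed

lemma rank_imp_acyclic:
  fixes h :: "'a \<Rightarrow> nat"
  assumes "\<And>a b. (a, b) \<in> R \<Longrightarrow> h a < h b"
  shows "acyclic R"
proof -
  have "acyclic (R\<inverse>)"
    using assms by (intro acyclicI_order[where f = h]) auto
  then show ?thesis by simp
qed

lemma arcs_ends_induce_subgraph_with_proj:
  "arcs_ends (with_proj D \<restriction> S) = {(a, b) \<in> parcs D. a \<in> S \<and> b \<in> S}"
  by (auto simp: arcs_ends_def arc_to_ends_def)

text \<open>
  The ranks of the different parts need not be compared: only arcs inside a part matter, so
  they can be chosen independently.
\<close>

lemma acyclic_partition_imp_ranked_coloring: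
  assumes D: "pair_digraph D" and P: "acyclic_partition D r P"
  shows "\<exists>f h. ranked_coloring D r f h"
proof -
  interpret pair_digraph D by fact
  have part: "partition_on (pverts D) P" and "finite P" "card P = r"
    and acyc: "\<And>S. S \<in> P \<Longrightarrow> acyclic_digraph (with_proj D \<restriction> S)"
    using P by (auto simp: acyclic_partition_def)
  have "\<forall>S\<in>P. \<exists>h :: 'a \<Rightarrow> nat. \<forall>(a, b) \<in> arcs_ends (with_proj D \<restriction> S). h a < h b"
  proof (intro ballI finite_acyclic_imp_rank)
    fix S assume "S \<in> P"
    show "finite (arcs_ends (with_proj D \<restriction> S))"
      unfolding arcs_ends_induce_subgraph_with_proj
      by (rule finite_subset[OF _ pair_finite_arcs]) auto
    show "acyclic (arcs_ends (with_proj D \<restriction> S))"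
      using acyc[OF \<open>S \<in> P\<close>] acyclic_digraph_iff_acyclic_arcs_ends[OF wellformed_induce_subgraph]
      by simp
  qed
  from bchoice[OF this] obtain h :: "'a set \<Rightarrow> 'a \<Rightarrow> nat"
    where h: "\<And>S a b. S \<in> P \<Longrightarrow> (a, b) \<in> parcs D \<Longrightarrow> a \<in> S \<Longrightarrow> b \<in> S \<Longrightarrow> h S a < h S b"
    unfolding arcs_ends_induce_subgraph_with_proj by blast
  have "\<forall>v\<in>pverts D. \<exists>S. S \<in> P \<and> v \<in> S"
    using partition_onD1[OF part] by blast
  from bchoice[OF this] obtain c where c: "\<And>v. v \<in> pverts D \<Longrightarrow> c v \<in> P \<and> v \<in> c v"
    by blast
  obtain e where "bij_betw e P {..<r}"
    using \<open>finite P\<close> \<open>card P = r\<close> by (metis ex_bij_betw_finite_nat atLeast0LessThan)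
  then have inj: "inj_on e P" and img: "e ` P = {..<r}"
    by (auto simp: bij_betw_def)
  have "ranked_coloring D r (\<lambda>v. e (c v)) (\<lambda>v. h (c v) v)"
    unfolding ranked_coloring_def
  proof (intro conjI ballI, use c img in blast, clarify)
    fix a b assume ab: "(a, b) \<in> parcs D" and eq: "e (c a) = e (c b)"
    have "a \<in> pverts D" "b \<in> pverts D"
      using in_arcsD1[OF ab] in_arcsD2[OF ab] by auto
    with c have "c a \<in> P" "a \<in> c a" "c b \<in> P" "b \<in> c b"
      by auto
    moreover from this have "c a = c b"
      using eq inj by (auto dest: inj_onD)
    ultimately show "h (c a) a < h (c b) b"
      using h ab by metis
  qed
  then show ?thesis by blast
qed

text \<open>
  The colour classes need not use all \<open>r\<close> colours, so they only give an acyclic partition with at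
  most \<open>r\<close> parts.
\<close>

lemma ranked_coloring_imp_dichromatic_number_le:
  assumes D: "pair_digraph D" and col: "ranked_coloring D r f h"
  shows "dichromatic_number D \<le> r"
proof -
  interpret pair_digraph D by fact
  let ?class = "\<lambda>i. {v \<in> pverts D. f v = i}"
  let ?P = "?class ` (f ` pverts D)"
  have "partition_on (pverts D) ?P"
    by (rule partition_onI) (auto simp: disjnt_def)
  moreover have "finite ?P"
    using pair_finite_verts by blast
  moreover have "acyclic_digraph (with_proj D \<restriction> ?class i)" for i
  proof -
    have "acyclic (arcs_ends (with_proj D \<restriction> ?class i))"
      using col unfolding arcs_ends_induce_subgraph_with_proj
      by (intro rank_imp_acyclic[where h = h]) (auto simp: ranked_coloring_def)
    then show ?thesis
      by (simp add: acyclic_digraph_iff_acyclic_arcs_ends[OF wellformed_induce_subgraph])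
  qed
  ultimately have "acyclic_partition D (card ?P) ?P"
    by (auto simp: acyclic_partition_def)
  then have "dichromatic_number D \<le> card ?P"
    unfolding dichromatic_number_def by (blast intro: Least_le)
  also have "\<dots> \<le> card (f ` pverts D)"
    using pair_finite_verts by (intro card_image_le) blast
  also have "\<dots> \<le> card {..<r}"
    using col by (intro card_mono) (auto simp: ranked_coloring_def)
  finally show ?thesis by simp
qed

text \<open>
  Both sums change only in the moved token. As the colours of single vertices are smaller than
  \<open>r\<close>, equality of the colour sums modulo \<open>r\<close> forces equality of the colours of the two ends of
  the arc along which the token moves.
\<close>

lemma ranked_coloring_token_digraph:
  assumes D: "pair_digraph D" and col: "ranked_coloring D r f h" and r: "0 < r"
  shows "ranked_coloring (token_digraph k D) r (\<lambda>A. (\<Sum>v\<in>A. f v) mod r) (\<lambda>A. \<Sum>v\<in>A. h v)"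
  unfolding ranked_coloring_def
proof (intro conjI ballI)
  show "(\<lambda>A. (\<Sum>v\<in>A. f v) mod r) ` pverts (token_digraph k D) \<subseteq> {..<r}"
    using r by auto
next
  interpret pair_digraph D by fact
  fix arc assume "arc \<in> parcs (token_digraph k D)"
  then obtain A B a b where arc: "arc = (A, B)" and A: "A \<subseteq> pverts D" and "B \<subseteq> pverts D"
    and diff: "A - B = {a}" "B - A = {b}" and ab: "(a, b) \<in> parcs D"
    unfolding token_digraph_def by auto
  define C where "C = A \<inter> B"
  have "finite C"
    using A pair_finite_verts by (auto simp: C_def intro: finite_subset)
  moreover have "A = insert a C" "B = insert b C" "a \<notin> C" "b \<notin> C"
    using diff by (auto simp: C_def)
  ultimately have sum: "sum g A = g a + sum g C" "sum g B = g b + sum g C" for g :: "'a \<Rightarrow> nat"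
    by simp_all
  have "a \<in> pverts D" "b \<in> pverts D"
    using diff A \<open>B \<subseteq> pverts D\<close> by auto
  then have less: "f a < r" "f b < r"
    using col by (auto simp: ranked_coloring_def)
  have "sum h A < sum h B" if "sum f A mod r = sum f B mod r"
  proof -
    have "[f a + sum f C = f b + sum f C] (mod r)"
      using that by (simp add: sum cong_def)
    then have "f a = f b"
      using less by (simp add: cong_add_rcancel_nat cong_less_modulus_unique_nat)
    then have "h a < h b"
      using col ab by (auto simp: ranked_coloring_def)
    then show ?thesis by (simp add: sum)
  qed
  then show "case arc of (A, B) \<Rightarrow>
      sum f A mod r = sum f B mod r \<longrightarrow> sum h A < sum h B"
    by (simp add: arc)
qed

theorem theorem9p1:
  fixes D :: "'a pair_pre_digraph" and k :: nat
  assumes "pair_digraph D"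
    and "1 \<le> k" and "k \<le> card (pverts D) - 1"
  shows "dichromatic_number (token_digraph k D) \<le> dichromatic_number D"
proof -
  let ?r = "dichromatic_number D"
  obtain f h where col: "ranked_coloring D ?r f h"
    using ex_acyclic_partition_dichromatic_number acyclic_partition_imp_ranked_coloring assms(1)
    by metis
  have "pverts D \<noteq> {}"
    using assms(2,3) by auto
  then have "0 < ?r"
    using col by (auto simp: ranked_coloring_def)
  then show ?thesis
    using ranked_coloring_imp_dichromatic_number_le[OF pair_digraph_token_digraph]
      ranked_coloring_token_digraph[OF assms(1) col] assms(1) by blast
qed

end
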